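(* Let $G$ be a chordless graph. Then either $G$ is sparse or $G$ admits a $1$-cutset or a proper $2$-cutset.
   Context: Graphs are finite and simple. A graph is chordless if all its cycles are chordless, i.e. every cycle of it is an induced subgraph. A graph $G$ is sparse if for every edge $uv$ of $G$ we have $\deg(u)\le 2$ or $\deg(v)\le 2$. A $k$-cutset of $G$ is a set $S\subset V(G)$ of size $k$ such that $G\setminus S$ is disconnected. A proper $2$-cutset of $G$ is a $2$-cutset $\{a,b\}$ such that $ab\notin E(G)$ and $V(G)\setminus\{a,b\}$ can be partitioned into two non-empty sets $X,Y$ with no edge between $X$ and $Y$ and such that neither $G[X\cup\{a,b\}]$ nor $G[Y\cup\{a,b\}]$ is a path with ends $a,b$. *)

theory Defs
  imports "Graph_Theory.Graph_Theory"
begin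

text \<open>
  Finite simple graphs are given by the locale \<^locale>\<open>graph\<close> (finite, loop-free, symmetric
  digraphs without parallel arcs): an edge \<open>uv\<close> is represented by the two arcs \<open>(u,v)\<close>
  and \<open>(v,u)\<close>, and so the degree of \<open>v\<close> is \<^term>\<open>out_degree G v\<close>.
\<close>

text \<open>
  The edges traversed by a walk, each with both of its arcs: a walk in \<^const>\<open>arcs\<close> uses an
  edge in one direction only, while an undirected subgraph must contain both.
\<close>
definition walk_edges :: "('a,'b) pre_digraph \<Rightarrow> 'b awalk \<Rightarrow> 'b set" where
  "walk_edges G p =
     {e \<in> arcs G. \<exists>f \<in> set p. {tail G e, head G e} = {tail G f, head G f}}"

definition walk_subgraph :: "('a,'b) pre_digraph \<Rightarrow> 'a \<Rightarrow> 'b awalk \<Rightarrow> ('a,'b) pre_digraph" where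
  "walk_subgraph G u p =
     \<lparr> verts = set (pre_digraph.awalk_verts G u p), arcs = walk_edges G p,
       tail = tail G, head = head G \<rparr>"

text \<open>
  In a symmetric digraph \<^const>\<open>pre_digraph.cycle\<close> also accepts the closed walks that go
  along an edge and back; requiring length at least 3 leaves exactly the cycles of the simple graph.
\<close>
definition chordless :: "('a,'b) pre_digraph \<Rightarrow> bool" where
  "chordless G \<longleftrightarrow>
     (\<forall>c. pre_digraph.cycle G c \<and> length c \<ge> 3 \<longrightarrow>
          induced_subgraph (walk_subgraph G (tail G (hd c)) c) G)"

definition sparse :: "('a,'b) pre_digraph \<Rightarrow> bool" where
  "sparse G \<longleftrightarrow> (\<forall>e \<in> arcs G. out_degree G (tail G e) \<le> 2 \<or> out_degree G (head G e) \<le> 2)"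

text \<open>
  The library's \<^const>\<open>connected\<close> is false for the graph without vertices, which is
  not to count as disconnected here.
\<close>
definition disconnected :: "('a,'b) pre_digraph \<Rightarrow> bool" where
  "disconnected G \<longleftrightarrow> verts G \<noteq> {} \<and> \<not> connected G"

definition cutset :: "nat \<Rightarrow> ('a,'b) pre_digraph \<Rightarrow> 'a set \<Rightarrow> bool" where
  "cutset k G S \<longleftrightarrow> S \<subset> verts G \<and> card S = k \<and> disconnected (G \<restriction> (verts G - S))"

definition path_graph :: "('a,'b) pre_digraph \<Rightarrow> 'a \<Rightarrow> 'a \<Rightarrow> bool" where
  "path_graph H a b \<longleftrightarrow> (\<exists>p. pre_digraph.apath H a p b \<and> walk_subgraph H a p = H)"

definition proper_2_cutset :: "('a,'b) pre_digraph \<Rightarrow> 'a \<Rightarrow> 'a \<Rightarrow> bool" where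
  "proper_2_cutset G a b \<longleftrightarrow>
     cutset 2 G {a, b} \<and> \<not> a \<rightarrow>\<^bsub>G\<^esub> b \<and>
     (\<exists>X Y. X \<noteq> {} \<and> Y \<noteq> {} \<and> X \<inter> Y = {} \<and> X \<union> Y = verts G - {a, b} \<and>
        (\<forall>x \<in> X. \<forall>y \<in> Y. \<not> x \<rightarrow>\<^bsub>G\<^esub> y) \<and>
        \<not> path_graph (G \<restriction> (X \<union> {a, b})) a b \<and>
        \<not> path_graph (G \<restriction> (Y \<union> {a, b})) a b)"

end

(* In a graph without cut vertex, let uv be an edge whose ends have degree at least 3. If G - uv were
   still 2-connected, u and v would lie on a common cycle of it, with chord uv. So some vertex w
   separates u from v in G - uv: the sides X (containing u) and Y (containing v) of V - w are joined by
   uv alone. Then uw is not an edge, and {u, w} separates X - u from Y. It is a proper 2-cutset because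
   u has two neighbours in X, while an end of a path has one, and v keeps all its neighbours, at least
   three, in G[Y + u + w]. *)

theory Submission
  imports Defs
begin

section \<open>Cycles through two vertices\<close>

text \<open>Cycles as vertex lists, so that rotating, reversing and splicing are list operations.
  The first vertex is not repeated at the end, and length at least 3 rules out an edge walked there
  and back.\<close>

definition vcycle :: "('a \<times> 'a) set \<Rightarrow> 'a list \<Rightarrow> bool" where
  "vcycle E c \<longleftrightarrow> distinct c \<and> 3 \<le> length c \<and> successively (\<lambda>x y. (x, y) \<in> E) c \<and> (last c, hd c) \<in> E"

text \<open>2-connectedness as the absence of a cut vertex. Sets \<open>V\<close> with at most two
  vertices satisfy it trivially, which is why \<open>biconnected_on_ex_vcycle\<close> asks for a
  third vertex \<open>t\<close>.\<close>

definition biconnected_on :: "'a set \<Rightarrow> ('a \<times> 'a) set \<Rightarrow> bool" where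
  "biconnected_on V E \<longleftrightarrow>
     (\<forall>w \<in> V. \<forall>x \<in> V - {w}. \<forall>y \<in> V - {w}. (x, y) \<in> rtrancl_on (V - {w}) E)"

lemma biconnected_onD:
  assumes "biconnected_on V E" "w \<in> V" "x \<in> V" "y \<in> V" "x \<noteq> w" "y \<noteq> w"
  shows "(x, y) \<in> rtrancl_on (V - {w}) E"
  using assms by (auto simp: biconnected_on_def)

lemma vcycle_swap:
  assumes "vcycle E (p @ q)"
  shows "vcycle E (q @ p)"
  using assms
  by (cases "p = []"; cases "q = []") (auto simp: vcycle_def successively_append_iff)

lemma vcycle_rev:
  assumes "sym E" "vcycle E c"
  shows "vcycle E (rev c)"
proof -
  have "successively (\<lambda>x y. (y, x) \<in> E) c"
    using assms by (auto simp: vcycle_def elim!: successively_mono dest: symD)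
  moreover have "(hd c, last c) \<in> E"
    using assms by (auto simp: vcycle_def dest: symD)
  moreover have "c \<noteq> []" using assms by (auto simp: vcycle_def)
  ultimately show ?thesis
    using assms by (simp add: vcycle_def hd_rev last_rev)
qed

lemma rtrancl_on_imp_path:
  assumes "(x, y) \<in> rtrancl_on A E"
  obtains p where "p \<noteq> []" "hd p = x" "last p = y" "distinct p" "set p \<subseteq> A"
    "successively (\<lambda>x y. (x, y) \<in> E) p"
proof -
  have "\<exists>p. p \<noteq> [] \<and> hd p = x \<and> last p = y \<and> distinct p \<and> set p \<subseteq> A
      \<and> successively (\<lambda>x y. (x, y) \<in> E) p"
    using assms
  proof (induction rule: converse_rtrancl_on_induct)
    case base
    then show ?case by (intro exI[of _ "[y]"]) auto
  next
    case (step x x')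
    then obtain p where p: "p \<noteq> []" "hd p = x'" "last p = y" "distinct p" "set p \<subseteq> A"
      "successively (\<lambda>x y. (x, y) \<in> E) p" by blast
    show ?case
    proof (cases "x \<in> set p")
      case True
      then obtain q r where "p = q @ x # r" by (auto simp: in_set_conv_decomp)
      with p show ?thesis
        by (intro exI[of _ "x # r"]) (auto simp: successively_append_iff)
    next
      case False
      with p step show ?thesis
        by (intro exI[of _ "x # p"]) (cases p; auto)
    qed
  qed
  with that show thesis by blast
qed

text \<open>Since \<open>x\<close> is not a cut vertex, a path from \<open>y\<close> avoiding
  \<open>x\<close> reaches the cycle. With the edge \<open>xy\<close> it forms an ear attached at
  \<open>x\<close> and at the first cycle vertex \<open>z\<close> that it meets; the ear and an arc
  of the cycle from \<open>z\<close> to \<open>x\<close> containing \<open>u\<close> form the new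
  cycle.\<close>

lemma vcycle_extend:
  assumes "sym E" "E \<subseteq> V \<times> V" "biconnected_on V E"
    and c: "vcycle E c" "u \<in> set c" "x \<in> set c"
    and xy: "(x, y) \<in> E" "x \<noteq> y"
  shows "\<exists>c. vcycle E c \<and> u \<in> set c \<and> y \<in> set c"
proof (cases "y \<in> set c")
  case True
  with c show ?thesis by blast
next
  case y: False
  \<comment> \<open>A vertex of the cycle other than \<open>x\<close>, at which the path from
    \<open>y\<close> can aim: \<open>u\<close> itself, unless \<open>u = x\<close>.\<close>
  obtain t where t: "t \<in> set c" "t \<noteq> x" "u \<noteq> x \<Longrightarrow> t = u"
  proof (cases "u = x")
    case True
    have "\<not> set c \<subseteq> {x}"
      using c(1) card_mono[of "{x}" "set c"] by (auto simp: vcycle_def distinct_card)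
    with True that show thesis by blast
  qed (use c in blast)
  have cV: "a \<in> V" if "a \<in> set c" for a
  proof -
    from that obtain p q where pq: "c = p @ a # q" by (auto simp: in_set_conv_decomp)
    have "vcycle E ((a # q) @ p)" using c(1) pq vcycle_swap by metis
    then have "(last (q @ p), a) \<in> E \<or> q @ p = []" by (auto simp: vcycle_def split: if_splits)
    then show ?thesis using assms(2) c(1) pq by (auto simp: vcycle_def)
  qed
  have "(y, t) \<in> rtrancl_on (V - {x}) E"
    using assms(2,3) xy t(1,2) cV c(3) by (intro biconnected_onD) auto
  then obtain p where p: "p \<noteq> []" "hd p = y" "last p = t" "distinct p" "set p \<subseteq> V - {x}"
    "successively (\<lambda>x y. (x, y) \<in> E) p" by (rule rtrancl_on_imp_path)
  obtain q z r where qzr: "p = q @ z # r" "z \<in> set c" "\<forall>a \<in> set q. a \<notin> set c"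
    using split_list_first_prop[of p "\<lambda>a. a \<in> set c"] p(1,3) t(1) last_in_set by metis
  have q: "q \<noteq> []" "hd q = y" using qzr p(2) y by (cases q; auto)+
  have zx: "z \<noteq> x" using p(5) qzr(1) by auto
  obtain d where d: "vcycle E (x # d)" "set (x # d) = set c"
  proof -
    obtain c1 c2 where c12: "c = c1 @ x # c2" using c(3) by (auto simp: in_set_conv_decomp)
    have "vcycle E ((x # c2) @ c1)" using c(1) c12 vcycle_swap by metis
    with that[of "c2 @ c1"] c12 show thesis by auto
  qed
  \<comment> \<open>The new cycle runs from \<open>y\<close> along \<open>q\<close> to
    \<open>z\<close>, on through \<open>d2\<close> to \<open>x\<close>, and closes with
    \<open>xy\<close>. The arc \<open>d1\<close> is dropped, so \<open>u\<close> must not lie on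
    it.\<close>
  have close: ?thesis if e: "vcycle E (x # d1 @ z # d2)" "set (x # d1 @ z # d2) = set c"
    "u \<in> set (x # z # d2)" for d1 d2
  proof -
    have "vcycle E (q @ z # d2 @ [x])"
    proof -
      have "successively (\<lambda>x y. (x, y) \<in> E) (z # d2)"
        using e(1) by (auto simp: vcycle_def successively_Cons successively_append_iff split: if_splits)
      moreover have "(last (z # d2), x) \<in> E"
        using e(1) by (auto simp: vcycle_def)
      ultimately have "successively (\<lambda>x y. (x, y) \<in> E) (z # d2 @ [x])"
        using successively_append_iff[of _ "z # d2" "[x]"] by simp
      moreover have "set q \<inter> set (x # z # d2) = {}" using qzr(3) e(2) by auto
      moreover have "distinct (x # z # d2)" using e(1) by (auto simp: vcycle_def)
      moreover have "length q > 0" using q by simp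
      moreover have "successively (\<lambda>x y. (x, y) \<in> E) q" "(last q, z) \<in> E" "distinct q"
        using p(4,6) qzr(1) q by (auto simp: successively_append_iff)
      ultimately show ?thesis
        using q xy by (auto simp: vcycle_def successively_append_iff
            simp del: length_greater_0_conv intro: Suc_leI)
    qed
    moreover have "u \<in> set (q @ z # d2 @ [x])" "y \<in> set (q @ z # d2 @ [x])"
      using e(3) q by (auto intro: hd_in_set)
    ultimately show ?thesis by blast
  qed
  have "z \<in> set d" using d(2) qzr(2) zx by auto
  then obtain d1 d2 where d12: "d = d1 @ z # d2" by (auto simp: in_set_conv_decomp)
  show ?thesis
  proof (cases "u \<in> set (x # z # d2)")
    case True
    with d d12 close show ?thesis by metis
  next
    case False
    \<comment> \<open>Here \<open>u\<close> lies on the arc that \<open>close\<close> would drop;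
      reversing the cycle exchanges the two arcs.\<close>
    have "u \<in> set d1" using False d d12 c(2) by auto
    have "vcycle E (rev d @ [x])" using vcycle_rev[OF assms(1) d(1)] by simp
    then have "vcycle E (x # rev d2 @ z # rev d1)"
      using vcycle_swap[of E "rev d" "[x]"] d12 by simp
    moreover have "set (x # rev d2 @ z # rev d1) = set c" using d d12 by auto
    ultimately show ?thesis using close[of "rev d2" "rev d1"] \<open>u \<in> set d1\<close> by auto
  qed
qed

text \<open>A cycle through \<open>u\<close> alone comes first: two neighbours of \<open>u\<close>,
  joined by a path avoiding \<open>u\<close>. Then \<open>vcycle_extend\<close> carries the second
  vertex along a walk from \<open>u\<close> to \<open>v\<close>, with \<open>u\<close> held
  fixed.\<close>

lemma biconnected_on_ex_vcycle:
  assumes "sym E" "E \<subseteq> V \<times> V" "irrefl E" "biconnected_on V E"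
    and "u \<in> V" "v \<in> V" "t \<in> V" "distinct [u, v, t]"
  shows "\<exists>c. vcycle E c \<and> u \<in> set c \<and> v \<in> set c"
proof -
  \<comment> \<open>A walk from \<open>u\<close> to \<open>t\<close> avoiding \<open>v\<close>
    starts with a neighbour \<open>y\<close> of \<open>u\<close> other than \<open>v\<close>. So
    \<open>v\<close> survives the deletion of \<open>y\<close>, and a walk to it gives a second
    neighbour \<open>y'\<close>.\<close>
  have "(u, t) \<in> rtrancl_on (V - {v}) E" using assms by (intro biconnected_onD) auto
  then obtain y where y: "(u, y) \<in> E" "y \<in> V - {v}" "y \<noteq> u"
    using assms(3,8) by (cases rule: converse_rtrancl_on_cases)
      (auto simp: irrefl_def dest: in_rtrancl_on_in_F)
  then have "(u, v) \<in> rtrancl_on (V - {y}) E" using assms by (intro biconnected_onD) auto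
  then obtain y' where y': "(u, y') \<in> E" "y' \<in> V - {y}" "y' \<noteq> u"
    using assms(3,8) by (cases rule: converse_rtrancl_on_cases)
      (auto simp: irrefl_def dest: in_rtrancl_on_in_F)
  have "(y', y) \<in> rtrancl_on (V - {u}) E" using assms y y' by (intro biconnected_onD) auto
  then obtain p where p: "p \<noteq> []" "hd p = y'" "last p = y" "distinct p" "set p \<subseteq> V - {u}"
    "successively (\<lambda>x y. (x, y) \<in> E) p" by (rule rtrancl_on_imp_path)
  have "length p \<ge> 2" using p(1-3) y'(2) by (cases p; cases "tl p") auto
  then have "vcycle E (u # p)"
    using p y y' assms(1) by (auto simp: vcycle_def successively_Cons dest: symD)
  then have cycle_u: "\<exists>c. vcycle E c \<and> u \<in> set c \<and> u \<in> set c"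
    by (intro exI[of _ "u # p"]) simp
  have "(u, v) \<in> rtrancl_on (V - {t}) E" using assms by (intro biconnected_onD) auto
  then show ?thesis
  proof (induction rule: rtrancl_on_induct)
    case base
    show ?case by (fact cycle_u)
  next
    case (step x y)
    then show ?case using vcycle_extend[OF assms(1,2,4)] assms(3) by (metis irrefl_def)
  qed
qed

section \<open>Separating the ends of an edge\<close>

text \<open>Otherwise deleting the edge leaves a biconnected graph, and \<open>xy\<close> is a chord of
  a cycle through \<open>x\<close> and \<open>y\<close> in it.\<close>
lemma ex_separator_of_edge_ends:
  assumes "sym E" "E \<subseteq> V \<times> V" "irrefl E" "biconnected_on V E"
    and "(x, y) \<in> E" "t \<in> V - {x, y}"
    and chordless: "\<And>c. vcycle (E - {(x, y), (y, x)}) c \<Longrightarrow> x \<notin> set c \<or> y \<notin> set c"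
  obtains z where "z \<in> V - {x, y}" "(x, y) \<notin> rtrancl_on (V - {z}) (E - {(x, y), (y, x)})"
proof -
  let ?F = "E - {(x, y), (y, x)}"
  have symF: "sym ?F" using assms(1) by (auto simp: sym_def)
  have "\<exists>z \<in> V - {x, y}. (x, y) \<notin> rtrancl_on (V - {z}) ?F"
  proof (rule ccontr)
    assume "\<not> ?thesis"
    then have con: "(x, y) \<in> rtrancl_on (V - {z}) ?F" if "z \<in> V - {x, y}" for z
      using that by blast
    \<comment> \<open>An edge of the walk that is missing from \<open>?F\<close> is
      \<open>xy\<close> itself. Both its ends then differ from \<open>w\<close>, so
      \<open>con\<close> for \<open>w\<close> gives a detour.\<close>
    have "(a, b) \<in> rtrancl_on (V - {w}) ?F" if "(a, b) \<in> rtrancl_on (V - {w}) E" "w \<in> V" for a b w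
      using that(1)
    proof (induction rule: rtrancl_on_induct)
      case base
      then show ?case by (rule rtrancl_on_refl)
    next
      case (step c d)
      have "(c, d) \<in> rtrancl_on (V - {w}) ?F"
      proof (cases "(c, d) \<in> ?F")
        case True
        with step(3,4) show ?thesis by (meson rtrancl_on_into_rtrancl_on rtrancl_on_refl)
      next
        case False
        then have "(c, d) = (x, y) \<or> (c, d) = (y, x)" using step(2) by blast
        moreover have "(x, y) \<in> rtrancl_on (V - {w}) ?F"
          using calculation step(3,4) that(2) by (intro con) auto
        ultimately show ?thesis using rtrancl_on_sym[OF symF, of "V - {w}"] by (auto dest: symD)
      qed
      with step.IH show ?case by (rule rtrancl_on_trans)
    qed
    then have "biconnected_on V ?F" using assms(4) by (simp add: biconnected_on_def)
    then have "\<exists>c. vcycle ?F c \<and> x \<in> set c \<and> y \<in> set c"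
      using assms symF by (intro biconnected_on_ex_vcycle[of _ V x y t]) (auto simp: irrefl_def)
    then show False using chordless by blast
  qed
  with that show thesis by blast
qed

text \<open>Cut the walk at its first edge out of \<open>S\<close>. The part before it is confined
  to edges within \<open>S\<close>, so it survives the deletion of edges that have an end outside
  \<open>S\<close>.\<close>

lemma rtrancl_on_leaving:
  assumes "(a, b) \<in> rtrancl_on A E" "a \<in> S" "b \<notin> S"
  obtains c d where "(a, c) \<in> rtrancl_on (A \<inter> S) (E \<inter> S \<times> S)" "c \<in> S" "(c, d) \<in> E"
    "c \<in> A" "d \<in> A" "d \<notin> S"
proof -
  let ?R = "rtrancl_on (A \<inter> S) (E \<inter> S \<times> S)"
  have "(b \<in> S \<and> (a, b) \<in> ?R) \<or>
    (\<exists>c d. (a, c) \<in> ?R \<and> c \<in> S \<and> (c, d) \<in> E \<and> c \<in> A \<and> d \<in> A \<and> d \<notin> S)"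
    using assms(1)
  proof (induction rule: rtrancl_on_induct)
    case base
    with assms(2) show ?case by auto
  next
    case (step y z)
    from step.IH show ?case
    proof
      assume "y \<in> S \<and> (a, y) \<in> ?R"
      with step(2-4) show ?thesis by (cases "z \<in> S") (auto intro: rtrancl_on_into_rtrancl_on)
    qed blast
  qed
  with assms(3) that show thesis by blast
qed

text \<open>If \<open>uw\<close> were an edge, a vertex separating its ends in \<open>E - uw\<close> would lie outside \<open>X\<close> or
  outside \<open>Y\<close>, but \<open>u\<close> and \<open>w\<close> are joined by a path of length at least 2 through each side.\<close>
lemma separation_at_edge:
  assumes E: "sym E" "E \<subseteq> V \<times> V" "irrefl E" "biconnected_on V E"
    and chordless: "\<And>x y c. \<lbrakk>(x, y) \<in> E; vcycle (E - {(x, y), (y, x)}) c\<rbrakk> \<Longrightarrow> x \<notin> set c \<or> y \<notin> set c"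
    and uv: "(u, v) \<in> E" and deg: "\<And>w. \<not> E `` {u} \<subseteq> {v, w}"
  obtains w X Y where "w \<in> V" "u \<in> X" "v \<in> Y" "X \<inter> Y = {}" "X \<union> Y = V - {w}"
    "\<And>x y. \<lbrakk>x \<in> X; y \<in> Y; (x, y) \<in> E\<rbrakk> \<Longrightarrow> x = u \<and> y = v" "(u, w) \<notin> E"
proof -
  have V: "u \<in> V" "v \<in> V" using uv E(2) by auto
  have ne: "a \<noteq> b" if "(a, b) \<in> E" for a b using that E(3) by (auto simp: irrefl_def)
  obtain t where "(u, t) \<in> E" "t \<noteq> v" using deg[of v] by auto
  then have "t \<in> V - {u, v}" using E(2) ne by auto
  then obtain w where w: "w \<in> V - {u, v}"
    "(u, v) \<notin> rtrancl_on (V - {w}) (E - {(u, v), (v, u)})"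
    using ex_separator_of_edge_ends[OF E uv _ chordless] uv by blast
  \<comment> \<open>\<open>X\<close> is the component of \<open>u\<close> once \<open>w\<close> and
    the edge \<open>uv\<close> are deleted, so any other edge from \<open>X\<close> to
    \<open>Y\<close> would enlarge it.\<close>
  define X where "X = {x. (u, x) \<in> rtrancl_on (V - {w}) (E - {(u, v), (v, u)})}"
  define Y where "Y = V - {w} - X"
  have uX: "u \<in> X" using V w(1) by (auto simp: X_def)
  have vY: "v \<in> Y" using V w by (auto simp: Y_def X_def)
  have XV: "X \<subseteq> V - {w}" by (auto simp: X_def dest: in_rtrancl_on_in_F)
  have cross: "x = u \<and> y = v" if "x \<in> X" "y \<in> Y" "(x, y) \<in> E" for x y
  proof -
    have "(x, y) \<in> {(u, v), (v, u)}"
      using that by (auto simp: X_def Y_def intro: rtrancl_on_into_rtrancl_on)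
    moreover have "v \<notin> X" using vY by (simp add: Y_def)
    ultimately show ?thesis using that(1) by auto
  qed
  have "(u, w) \<notin> E"
  proof
    assume uw: "(u, w) \<in> E"
    let ?F = "E - {(u, w), (w, u)}"
    obtain z where z: "z \<in> V - {u, w}" "(u, w) \<notin> rtrancl_on (V - {z}) ?F"
      using ex_separator_of_edge_ends[OF E uw _ chordless] uw V w(1) ne[OF uv] by blast
    \<comment> \<open>A set \<open>S\<close> that misses \<open>z\<close> and is adjacent outside
      itself only to \<open>u\<close> and \<open>w\<close> yields a walk from \<open>u\<close>
      through \<open>S\<close> to \<open>w\<close> in \<open>?F\<close>: a walk from
      \<open>s\<close> to \<open>w\<close> that avoids \<open>u\<close> can leave \<open>S\<close>
      only to \<open>w\<close>.\<close>
    have avoid: False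
      if S: "S \<subseteq> V - {u, w}" "s \<in> S" "(u, s) \<in> E" "z \<notin> S"
        "\<And>a b. \<lbrakk>a \<in> S; (a, b) \<in> E\<rbrakk> \<Longrightarrow> b \<in> S \<union> {u, w}" for S s
    proof -
      have "(s, w) \<in> rtrancl_on (V - {u}) E"
        using S V w(1) E(4) by (intro biconnected_onD) auto
      moreover have "w \<notin> S" using S(1) by auto
      ultimately obtain c d where cd: "(s, c) \<in> rtrancl_on ((V - {u}) \<inter> S) (E \<inter> S \<times> S)"
        "c \<in> S" "(c, d) \<in> E" "d \<in> V - {u}" "d \<notin> S"
        using rtrancl_on_leaving[of s w "V - {u}" E S] S(2) by blast
      have "d = w" using S(5) cd by blast
      have "(s, c) \<in> rtrancl_on (V - {z}) ?F"
        using S(1,4) by (intro rtrancl_on_mono[OF _ _ cd(1)]) auto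
      moreover have "(u, s) \<in> ?F" "(c, w) \<in> ?F" using S(1-3) cd \<open>d = w\<close> by auto
      moreover have "u \<in> V - {z}" "w \<in> V - {z}" using z V w(1) by auto
      ultimately have "(u, w) \<in> rtrancl_on (V - {z}) ?F"
        by (meson converse_rtrancl_on_into_rtrancl_on rtrancl_on_into_rtrancl_on)
      with z(2) show False ..
    qed
    show False
    proof (cases "z \<in> X")
      case True
      show False
      proof (rule avoid[of Y v])
        show "b \<in> Y \<union> {u, w}" if "a \<in> Y" "(a, b) \<in> E" for a b
          using that E(2) symD[OF E(1)] cross[of b a] by (auto simp: Y_def)
      qed (use uX vY uv True in \<open>auto simp: Y_def\<close>)
    next
      case False
      \<comment> \<open>\<open>deg\<close> provides a neighbour besides \<open>v\<close> and
        \<open>w\<close>; it lies in \<open>X\<close>, since \<open>uv\<close> is the only edge from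
        \<open>u\<close> into \<open>Y\<close>.\<close>
      obtain u' where u': "(u, u') \<in> E" "u' \<noteq> v" "u' \<noteq> w" using deg[of w] by auto
      then have "u' \<in> X" using E(2) cross[OF uX] by (auto simp: Y_def)
      show False
      proof (rule avoid[of "X - {u}" u'])
        show "b \<in> X - {u} \<union> {u, w}" if "a \<in> X - {u}" "(a, b) \<in> E" for a b
          using that E(2) cross[of a b] by (auto simp: Y_def)
      qed (use XV u' \<open>u' \<in> X\<close> ne[of u u'] False in auto)
    qed
  qed
  show thesis
  proof (rule that)
    show "w \<in> V" "u \<in> X" "v \<in> Y" "(u, w) \<notin> E" using w(1) uX vY \<open>(u, w) \<notin> E\<close> by blast+
    show "X \<inter> Y = {}" "X \<union> Y = V - {w}" using XV by (auto simp: Y_def)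
  qed (use cross in blast)+
qed

section \<open>Translation to digraphs\<close>

lemma arcs_ends_induce_subgraph: "arcs_ends (G \<restriction> A) = arcs_ends G \<inter> A \<times> A"
  by (auto simp: arcs_ends_conv)

lemma rtrancl_on_restrict: "rtrancl_on A (E \<inter> A \<times> A) = rtrancl_on A E"
proof (intro set_eqI iffI; clarify)
  fix x y
  assume "(x, y) \<in> rtrancl_on A (E \<inter> A \<times> A)"
  then show "(x, y) \<in> rtrancl_on A E" by (rule rtrancl_on_mono[rotated 2]) auto
next
  fix x y
  assume "(x, y) \<in> rtrancl_on A E"
  then show "(x, y) \<in> rtrancl_on A (E \<inter> A \<times> A)"
    by (induction rule: rtrancl_on_induct) (auto intro: rtrancl_on_into_rtrancl_on)
qed

text \<open>The notion \<open>connected\<close> is defined through the symmetric closure; as the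
  arcs are symmetric already, plain reachability inside \<open>A\<close> says the same.\<close>

lemma (in sym_digraph) connected_induce_subgraph_iff:
  assumes "A \<subseteq> verts G"
  shows "connected (G \<restriction> A) \<longleftrightarrow> A \<noteq> {} \<and> (\<forall>x \<in> A. \<forall>y \<in> A. (x, y) \<in> rtrancl_on A (arcs_ends G))"
proof -
  interpret H: wf_digraph "G \<restriction> A" ..
  have "symmetric (G \<restriction> A)"
    by (rule induced_graph_imp_symmetric[OF sym_arcs induced_induce[OF assms]])
  then show ?thesis
    by (simp add: connected_def strongly_connected_def H.adj_mk_symmetric_eq reachable_def
        arcs_ends_induce_subgraph rtrancl_on_restrict)
qed

lemma (in sym_digraph) biconnected_onI:
  assumes "\<nexists>S. cutset 1 G S"
  shows "biconnected_on (verts G) (arcs_ends G)"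
  unfolding biconnected_on_def
proof (intro ballI)
  fix w x y
  assume w: "w \<in> verts G" and xy: "x \<in> verts G - {w}" "y \<in> verts G - {w}"
  have "\<not> cutset 1 G {w}" using assms by blast
  then have "connected (G \<restriction> (verts G - {w}))"
    using w xy by (auto simp: cutset_def disconnected_def)
  then show "(x, y) \<in> rtrancl_on (verts G - {w}) (arcs_ends G)"
    using xy by (simp add: connected_induce_subgraph_iff)
qed

text \<open>Passes from vertex lists to walks of arcs. \<open>E\<close> may be a proper part of
  \<open>arcs_ends G\<close>, and the arcs found stay in it, so that a deleted edge is known not to
  be used.\<close>

lemma (in wf_digraph) successively_imp_awalk:
  assumes "p \<noteq> []" "set p \<subseteq> verts G" "successively (\<lambda>x y. (x, y) \<in> E) p" "E \<subseteq> arcs_ends G"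
  shows "\<exists>q. awalk (hd p) q (last p) \<and> awalk_verts (hd p) q = p \<and> arc_to_ends G ` set q \<subseteq> E"
  using assms
proof (induction p rule: list_nonempty_induct)
  case (single x)
  then show ?case by (intro exI[of _ "[]"]) (auto simp: awalk_Nil_iff)
next
  case (cons x p)
  then obtain q where q: "awalk (hd p) q (last p)" "awalk_verts (hd p) q = p"
    "arc_to_ends G ` set q \<subseteq> E"
    by (auto simp: successively_Cons)
  have "(x, hd p) \<in> E" using cons by (simp add: successively_Cons)
  moreover from this obtain e where "e \<in> arcs G" "arc_to_ends G e = (x, hd p)"
    using cons.prems(3) by (auto simp: arcs_ends_def)
  ultimately show ?case
    using q cons.hyps by (intro exI[of _ "e # q"]) (auto simp: awalk_Cons_iff arc_to_ends_def)
qed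

text \<open>The list is a cycle of \<open>G\<close>, hence induced, so if it met both
  \<open>x\<close> and \<open>y\<close> it would have to traverse the edge \<open>xy\<close>; but
  all its arcs have their ends in the relation without that edge.\<close>

lemma (in graph) chordless_imp_no_chord:
  assumes "chordless G" "(x, y) \<in> arcs_ends G" "vcycle (arcs_ends G - {(x, y), (y, x)}) c"
  shows "x \<notin> set c \<or> y \<notin> set c"
proof (rule ccontr)
  let ?E = "arcs_ends G - {(x, y), (y, x)}"
  assume "\<not> ?thesis"
  then have xy: "x \<in> set c" "y \<in> set c" by auto
  \<comment> \<open>Appending \<open>hd c\<close> turns the closing edge into an ordinary step, and
    every entry of \<open>c\<close> then has a successor.\<close>
  have c: "distinct c" "3 \<le> length c" "successively (\<lambda>x y. (x, y) \<in> ?E) (c @ [hd c])" "c \<noteq> []"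
    using assms(3) by (auto simp: vcycle_def successively_append_iff)
  have "set c \<subseteq> verts G"
  proof
    fix a assume "a \<in> set c"
    then obtain p q where "c @ [hd c] = p @ a # q" "q \<noteq> []"
      by (metis append_Cons append_assoc append_is_Nil_conv in_set_conv_decomp not_Cons_self2)
    with c(3) have "(a, hd q) \<in> arcs_ends G" by (auto simp: successively_append_iff successively_Cons)
    then show "a \<in> verts G" by (auto dest: adj_in_verts)
  qed
  moreover have "hd c \<in> set c" using c(4) by simp
  ultimately have "hd c \<in> verts G" "set c \<subseteq> verts G" by auto
  with c obtain q where q: "awalk (hd c) q (hd c)" "awalk_verts (hd c) q = c @ [hd c]"
    "arc_to_ends G ` set q \<subseteq> ?E"
    using successively_imp_awalk[of "c @ [hd c]" ?E] by auto
  have len: "length q = length c" using arg_cong[OF q(2), of length] by (simp add: length_awalk_verts)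
  have "distinct (tl (c @ [hd c]))" using c(1,4) by (cases c) auto
  then have "cycle q" using q len c by (auto simp: cycle_def)
  then have "induced_subgraph (walk_subgraph G (tail G (hd q)) q) G"
    using assms(1) len c(2) by (simp add: chordless_def)
  moreover have "tail G (hd q) = hd c" using q(1) len c(2) by (cases q) (auto simp: awalk_Cons_iff)
  moreover obtain e where e: "e \<in> arcs G" "tail G e = x" "head G e = y"
    using assms(2) by blast
  ultimately have "e \<in> walk_edges G q"
    using xy q(2) by (auto simp: induced_subgraph_def walk_subgraph_def)
  then obtain f where "f \<in> set q" "{x, y} = {tail G f, head G f}"
    using e by (auto simp: walk_edges_def)
  then show False using q(3) by (auto simp: arc_to_ends_def doubleton_eq_iff)
qed

text \<open>A neighbour of \<open>x\<close> is the head of a path arc leaving \<open>x\<close> or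
  the tail of one entering it. The vertices of the path are distinct, so there is at most one arc of
  each kind, and none enters the start \<open>a\<close>.\<close>

lemma (in wf_digraph) card_neighbours_path_graph:
  assumes "path_graph G a b"
  shows "card (arcs_ends G `` {x}) \<le> (if x = a then 1 else 2)"
proof -
  obtain p where p: "apath a p b" "walk_subgraph G a p = G"
    using assms by (auto simp: path_graph_def)
  have arcs: "arcs G = walk_edges G p" using arg_cong[OF p(2), of arcs] by (simp add: walk_subgraph_def)
  define T where "T = {f \<in> set p. tail G f = x}"
  define H where "H = {f \<in> set p. head G f = x}"
  have cas: "cas a p b" and dist: "distinct (awalk_verts a p)" using p(1) by (auto simp: apath_def)
  have fin: "finite T" "finite H" by (simp_all add: T_def H_def)
  have "distinct (map (tail G) p)" using dist by (cases "p = []") (auto simp: awalk_verts_conv)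
  then have T: "card T \<le> 1"
    by (auto simp: T_def card_le_Suc0_iff_eq distinct_map inj_on_def)
  have "awalk_verts a p = a # map (head G) p" using cas by (induction p arbitrary: a) auto
  then have "distinct (a # map (head G) p)" using dist by simp
  then have H: "card H \<le> (if x = a then 0 else 1)"
    by (auto simp: H_def card_le_Suc0_iff_eq distinct_map inj_on_def)
  have "arcs_ends G `` {x} \<subseteq> head G ` T \<union> tail G ` H"
  proof
    fix y assume "y \<in> arcs_ends G `` {x}"
    then obtain e where e: "e \<in> arcs G" "tail G e = x" "head G e = y" by auto
    then obtain f where "f \<in> set p" "{x, y} = {tail G f, head G f}"
      unfolding arcs by (auto simp: walk_edges_def)
    then show "y \<in> head G ` T \<union> tail G ` H" by (auto simp: T_def H_def doubleton_eq_iff)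
  qed
  then have "card (arcs_ends G `` {x}) \<le> card (head G ` T \<union> tail G ` H)"
    using fin by (intro card_mono) auto
  also have "\<dots> \<le> card T + card H"
    using fin by (intro order_trans[OF card_Un_le add_mono] card_image_le)
  finally show ?thesis using T H by (auto split: if_splits)
qed

lemma (in nomulti_digraph) card_neighbours: "card (arcs_ends G `` {v}) = out_degree G v"
proof -
  have "inj_on (head G) (out_arcs G v)"
    by (auto intro!: inj_onI no_multi_arcs simp: arc_to_ends_def)
  moreover have "arcs_ends G `` {v} = head G ` out_arcs G v" by (auto simp: arcs_ends_conv)
  ultimately show ?thesis by (simp add: card_image out_degree_def)
qed

theorem theorem1p3:
  fixes G :: "('a,'b) pre_digraph"
  assumes "graph G"
    and "chordless G"
  shows "sparse G \<or> (\<exists>S. cutset 1 G S) \<or> (\<exists>a b. proper_2_cutset G a b)"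
proof -
  interpret graph G by fact
  let ?E = "arcs_ends G"
  have "\<exists>a b. proper_2_cutset G a b" if ns: "\<not> sparse G" and nc: "\<nexists>S. cutset 1 G S"
  proof -
    obtain e where e: "e \<in> arcs G" "out_degree G (tail G e) > 2" "out_degree G (head G e) > 2"
      using ns by (auto simp: sparse_def)
    define u v where "u = tail G e" and "v = head G e"
    have uv: "(u, v) \<in> ?E" using e(1) by (auto simp: arcs_ends_conv u_def v_def)
    have deg: "card (?E `` {u}) > 2" "card (?E `` {v}) > 2"
      using e by (simp_all add: card_neighbours u_def v_def)
    have E: "sym ?E" "?E \<subseteq> verts G \<times> verts G" "irrefl ?E"
      using sym_arcs adj_not_same by (auto simp: symmetric_def irrefl_def dest: adj_in_verts)
    have nsub: "\<not> ?E `` {u} \<subseteq> {v, w}" for w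
      using deg(1) card_mono[of "{v, w}" "?E `` {u}"] card_insert_le_m1[of 2 "{w}" v] by auto
    obtain w X Y where wXY: "w \<in> verts G" "u \<in> X" "v \<in> Y" "X \<inter> Y = {}" "X \<union> Y = verts G - {w}"
      "\<And>x y. \<lbrakk>x \<in> X; y \<in> Y; (x, y) \<in> ?E\<rbrakk> \<Longrightarrow> x = u \<and> y = v" "(u, w) \<notin> ?E"
      by (rule separation_at_edge[OF E biconnected_onI[OF nc] chordless_imp_no_chord[OF assms(2)]
            uv nsub], assumption+, rule that)
    have wuv: "w \<noteq> u" "w \<noteq> v" "u \<noteq> v" using wXY(2-5) by auto
    \<comment> \<open>Such a neighbour is not \<open>w\<close>, as \<open>uw\<close> is no edge, and
      not in \<open>Y\<close>, as only \<open>uv\<close> crosses.\<close>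
    have "?E `` {u} - {v} \<subseteq> X - {u}"
    proof
      fix b assume b: "b \<in> ?E `` {u} - {v}"
      then have "b \<in> verts G" "b \<noteq> u" "b \<noteq> w" using E(2,3) wXY(7) by (auto simp: irrefl_def)
      then show "b \<in> X - {u}" using wXY(2,5) wXY(6)[of u b] b by blast
    qed
    \<comment> \<open>One of these neighbours shows that \<open>X - {u}\<close> is nonempty; two of
      them keep \<open>u\<close> from being the end of a path in \<open>nX\<close>.\<close>
    moreover have card_u: "card (?E `` {u} - {v}) > 1" using deg(1) by (auto simp: card_Diff_singleton_if)
    then have "?E `` {u} - {v} \<noteq> {}" by (metis card.empty not_less_zero)
    ultimately obtain u' where u': "u' \<in> X - {u}" by blast
    have nbr_v: "?E `` {v} \<subseteq> Y \<union> {u, w}"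
    proof
      fix b assume b: "b \<in> ?E `` {v}"
      then have "b \<in> verts G" "(b, v) \<in> ?E" using E(1,2) by (auto dest: symD)
      then show "b \<in> Y \<union> {u, w}" using wXY(3,5) wXY(6)[of b v] by blast
    qed
    have no_edge: "(x, y) \<notin> ?E" if "x \<in> X - {u}" "y \<in> Y" for x y
      using wXY(6) that by blast
    \<comment> \<open>A walk leaving \<open>X - {u}\<close> while avoiding \<open>u\<close> and
      \<open>w\<close> would step directly into \<open>Y\<close>, which \<open>no_edge\<close>
      forbids.\<close>
    have "(u', v) \<notin> rtrancl_on (verts G - {u, w}) ?E"
    proof
      assume "(u', v) \<in> rtrancl_on (verts G - {u, w}) ?E"
      moreover have "v \<notin> X - {u}" using wXY(3,4) by auto
      ultimately obtain c d where "c \<in> X - {u}" "(c, d) \<in> ?E" "d \<in> verts G - {u, w}" "d \<notin> X - {u}"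
        using rtrancl_on_leaving[of u' v "verts G - {u, w}" ?E "X - {u}"] u' by blast
      then show False using no_edge[of c d] wXY(5) by auto
    qed
    moreover have "u' \<in> verts G - {u, w}" "v \<in> verts G - {u, w}" using u' wXY(3,5) wuv by auto
    ultimately have cut: "cutset 2 G {u, w}"
      using wXY(1) uv wuv E(2)
      by (auto simp: cutset_def disconnected_def connected_induce_subgraph_iff)
    have nX: "\<not> path_graph (G \<restriction> (X - {u} \<union> {u, w})) u w"
    proof
      assume "path_graph (G \<restriction> (X - {u} \<union> {u, w})) u w"
      then have "card (arcs_ends (G \<restriction> (X - {u} \<union> {u, w})) `` {u}) \<le> 1"
        using wf_digraph.card_neighbours_path_graph[OF wellformed_induce_subgraph, of _ u w u]
        by presburger
      moreover have "?E `` {u} - {v} \<subseteq> arcs_ends (G \<restriction> (X - {u} \<union> {u, w})) `` {u}"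
        using \<open>?E `` {u} - {v} \<subseteq> X - {u}\<close> by (auto simp: arcs_ends_induce_subgraph)
      moreover have "finite (arcs_ends (G \<restriction> (X - {u} \<union> {u, w})) `` {u})"
        by (rule finite_subset[of _ "verts G"]) (use E(2) in \<open>auto simp: arcs_ends_induce_subgraph\<close>)
      ultimately show False using card_u card_mono by (metis le_trans not_less)
    qed
    have nY: "\<not> path_graph (G \<restriction> (Y \<union> {u, w})) u w"
    proof
      assume "path_graph (G \<restriction> (Y \<union> {u, w})) u w"
      then have "card (arcs_ends (G \<restriction> (Y \<union> {u, w})) `` {v}) \<le> 2"
        using wf_digraph.card_neighbours_path_graph[OF wellformed_induce_subgraph, of _ u w v] wuv(3)
        by presburger
      moreover have "arcs_ends (G \<restriction> (Y \<union> {u, w})) `` {v} = ?E `` {v}"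
        using nbr_v wXY(3) by (auto simp: arcs_ends_induce_subgraph)
      ultimately show False using deg(2) by simp
    qed
    have "proper_2_cutset G u w"
      unfolding proper_2_cutset_def
    proof (intro conjI exI)
      show "X - {u} \<noteq> {}" "Y \<noteq> {}" using u' wXY(3) by blast+
      show "(X - {u}) \<inter> Y = {}" using wXY(4) by blast
      show "X - {u} \<union> Y = verts G - {u, w}" using wXY(2,4,5) by blast
      show "\<forall>x \<in> X - {u}. \<forall>y \<in> Y. (x, y) \<notin> ?E" using no_edge by blast
    qed (fact cut wXY(7) nX nY)+
    then show ?thesis by blast
  qed
  then show ?thesis by blast
qed

end
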